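(* Let $G=(V,A)$ be a simple directed graph on vertices $V=\{1,\dots,n\}$. Let $\mathbb{K}$ be a field whose characteristic does not divide $n$ and let $\omega\in\mathbb{K}$ be a primitive $n$-th root of unity. Consider the following system in $\mathbb{K}[x_1,\dots,x_n]$: $$H_G=\Big\{x_i^n-1=0,\ \ \prod_{j\in\delta^+(i)}(\omega x_i-x_j)=0\ :\ i\in V\Big\}.$$ The system $H_G$ has a solution over the algebraic closure $\overline{\mathbb{K}}$ if and only if $G$ has a Hamiltonian cycle.
   Context: Simple directed graph: no loops and no repeated arcs (both $(i,j)$ and $(j,i)$ may be present). $\delta^+(i)$ is the set of vertices $j$ such that $(i,j)\in A$; an empty product equals $1$. A Hamiltonian cycle is an ordering $v_1,\dots,v_n$ of all the vertices such that $(v_1,v_2),(v_2,v_3),\dots,(v_{n-1},v_n),(v_n,v_1)\in A$. *)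

theory Defs
  imports
    "HOL-Library.Poly_Mapping"
    "HOL-Algebra.Algebraic_Closure_Type"
    "Graph_Theory.Pair_Digraph"
begin

definition primitive_nth_root :: "nat \<Rightarrow> 'k::field \<Rightarrow> bool" where
  "primitive_nth_root n \<omega> \<longleftrightarrow> n > 0 \<and> \<omega> ^ n = 1 \<and> (\<forall>k. 0 < k \<and> k < n \<longrightarrow> \<omega> ^ k \<noteq> 1)"

text \<open>
  Polynomials in the variables \<open>x\<^sub>i\<close> (\<open>i\<close> a natural number): finitely supported
  coefficient functions on exponent vectors, the latter being themselves finitely supported.
  The ring structure (convolution product) is the one of \<^theory>\<open>HOL-Library.Poly_Mapping\<close>.
\<close>

type_synonym 'k mpoly = "(nat \<Rightarrow>\<^sub>0 nat) \<Rightarrow>\<^sub>0 'k"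

definition mvar :: "nat \<Rightarrow> 'k::field mpoly" where
  "mvar i = Poly_Mapping.single (Poly_Mapping.single i 1) 1"

definition mconst :: "'k::field \<Rightarrow> 'k mpoly" where
  "mconst c = Poly_Mapping.single 0 c"

definition eval_ac :: "(nat \<Rightarrow> 'k::field alg_closure) \<Rightarrow> 'k mpoly \<Rightarrow> 'k alg_closure" where
  "eval_ac x p = (\<Sum>m\<in>Poly_Mapping.keys p.
     to_ac (Poly_Mapping.lookup p m) * (\<Prod>i\<in>Poly_Mapping.keys m. x i ^ Poly_Mapping.lookup m i))"

text \<open>
  A point is a total function on the variable indices; the values at indices of variables that do
  not occur in \<open>S\<close> are irrelevant.
\<close>

definition solvable_over_ac :: "'k::field mpoly set \<Rightarrow> bool" where
  "solvable_over_ac S \<longleftrightarrow> (\<exists>x. \<forall>p\<in>S. eval_ac x p = 0)"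

definition out_nbrs :: "'v pair_pre_digraph \<Rightarrow> 'v \<Rightarrow> 'v set" where
  "out_nbrs G i = {j. (i, j) \<in> parcs G}"

definition hamiltonian_cycle :: "'v pair_pre_digraph \<Rightarrow> 'v list \<Rightarrow> bool" where
  "hamiltonian_cycle G vs \<longleftrightarrow>
     vs \<noteq> [] \<and> distinct vs \<and> set vs = pverts G \<and>
     (\<forall>k. Suc k < length vs \<longrightarrow> (vs ! k, vs ! Suc k) \<in> parcs G) \<and>
     (last vs, hd vs) \<in> parcs G"

definition H_system :: "nat pair_pre_digraph \<Rightarrow> nat \<Rightarrow> 'k::field \<Rightarrow> 'k mpoly set" where
  "H_system G n \<omega> =
     (\<Union>i\<in>pverts G. {mvar i ^ n - 1, \<Prod>j\<in>out_nbrs G i. (mconst \<omega> * mvar i - mvar j)})"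

end

theory Submission
  imports Defs
begin

text \<open>
  A solution assigns to each vertex an \<open>n\<close>-th root of unity, and the product equations
  say that every vertex has an out-neighbour whose value is \<open>\<omega>\<close> times its own. Following such
  out-neighbours produces values \<open>c, \<omega> c, \<omega>\<^sup>2 c, \<dots>\<close>, which are pairwise distinct for \<open>n\<close> steps
  and then return to \<open>c\<close>, so the walk is a Hamiltonian cycle. Conversely the \<open>k\<close>-th
  vertex of a Hamiltonian cycle gets the value \<open>\<omega>\<^sup>k\<close>.
\<close>

text \<open>The inner product of \<open>eval_ac\<close>, isolated so that its multiplicativity can
  be proved separately.\<close>

definition eval_monom :: "(nat \<Rightarrow> 'a::comm_semiring_1) \<Rightarrow> (nat \<Rightarrow>\<^sub>0 nat) \<Rightarrow> 'a" where
  "eval_monom x m = (\<Prod>i\<in>Poly_Mapping.keys m. x i ^ Poly_Mapping.lookup m i)"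

text \<open>Indices outside the support have exponent 0 and contribute a factor 1. Monomials with
  different supports can thus be compared over one common index set.\<close>

lemma eval_monom_superset:
  assumes "finite S" "Poly_Mapping.keys m \<subseteq> S"
  shows "eval_monom x m = (\<Prod>i\<in>S. x i ^ Poly_Mapping.lookup m i)"
  unfolding eval_monom_def
  by (rule prod.mono_neutral_left) (use assms in \<open>auto simp: in_keys_iff\<close>)

lemma eval_monom_0 [simp]: "eval_monom x 0 = 1"
  by (simp add: eval_monom_def)

lemma eval_monom_single [simp]: "eval_monom x (Poly_Mapping.single i k) = x i ^ k"
  by (simp add: eval_monom_def)

lemma eval_monom_add: "eval_monom x (m + m') = eval_monom x m * eval_monom x m'"
proof -
  let ?S = "Poly_Mapping.keys m \<union> Poly_Mapping.keys m'"
  have "eval_monom x (m + m') = (\<Prod>i\<in>?S. x i ^ Poly_Mapping.lookup (m + m') i)"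
    by (rule eval_monom_superset) (simp_all add: Poly_Mapping.keys_add)
  also have "\<dots> = (\<Prod>i\<in>?S. x i ^ Poly_Mapping.lookup m i) * (\<Prod>i\<in>?S. x i ^ Poly_Mapping.lookup m' i)"
    by (simp add: lookup_add power_add prod.distrib)
  also have "\<dots> = eval_monom x m * eval_monom x m'"
    by (simp add: eval_monom_superset [of ?S])
  finally show ?thesis .
qed

lemma eval_ac_superset:
  assumes "finite S" "Poly_Mapping.keys p \<subseteq> S"
  shows "eval_ac x p = (\<Sum>m\<in>S. to_ac (Poly_Mapping.lookup p m) * eval_monom x m)"
  unfolding eval_ac_def eval_monom_def
  by (rule sum.mono_neutral_left) (use assms in \<open>auto simp: in_keys_iff\<close>)

lemma eval_ac_0 [simp]: "eval_ac x 0 = 0"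
  by (simp add: eval_ac_def)

lemma eval_ac_single: "eval_ac x (Poly_Mapping.single m c) = to_ac c * eval_monom x m"
  by (subst eval_ac_superset [of "{m}"]) auto

lemma eval_ac_1 [simp]: "eval_ac x 1 = 1"
  using eval_ac_single [of x 0 1] by simp

lemma eval_ac_add: "eval_ac x (p + q) = eval_ac x p + eval_ac x q"
proof -
  let ?S = "Poly_Mapping.keys p \<union> Poly_Mapping.keys q"
  have "eval_ac x (p + q) = (\<Sum>m\<in>?S. to_ac (Poly_Mapping.lookup (p + q) m) * eval_monom x m)"
    by (rule eval_ac_superset) (simp_all add: Poly_Mapping.keys_add)
  also have "\<dots> = eval_ac x p + eval_ac x q"
    by (simp add: lookup_add distrib_right sum.distrib eval_ac_superset [of ?S])
  finally show ?thesis .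
qed

lemma eval_ac_diff: "eval_ac x (p - q) = eval_ac x p - eval_ac x q"
  using eval_ac_add [of x "p - q" q] by simp

text \<open>Every finitely supported mapping is a finite sum of \<open>single\<close> terms, so
  additive statements need checking only on these.\<close>

lemma poly_mapping_single_add_induct [case_names single add]:
  fixes p :: "'a \<Rightarrow>\<^sub>0 'b::monoid_add"
  assumes single: "\<And>m c. P (Poly_Mapping.single m c)"
    and add: "\<And>p q. P p \<Longrightarrow> P q \<Longrightarrow> P (p + q)"
  shows "P p"
proof (induction p rule: update_induct)
  case const
  \<comment> \<open>The zero mapping is a \<open>single\<close> with coefficient 0, so the key is
    arbitrary.\<close>
  then show ?case
    using single [of undefined 0] by simp
next
  case (update p m c)
  \<comment> \<open>The key \<open>m\<close> is new to \<open>p\<close>, hence overwriting its value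
    agrees with adding to it.\<close>
  have "Poly_Mapping.update m c p = p + Poly_Mapping.single m c"
    using update.hyps
    by (intro poly_mapping_eqI) (auto simp: lookup_update lookup_add lookup_single in_keys_iff when_def)
  then show ?case
    using add [OF update.IH single] by simp
qed

text \<open>Both sides are additive in each factor, which reduces the claim to two single terms and
  avoids unfolding the convolution.\<close>

lemma eval_ac_mult: "eval_ac x (p * q) = eval_ac x p * eval_ac x q"
proof (induction p rule: poly_mapping_single_add_induct)
  case (single m c)
  show ?case
  proof (induction q rule: poly_mapping_single_add_induct)
    case (single m' c')
    then show ?case
      by (simp add: mult_single eval_ac_single eval_monom_add)
  next
    case (add f g)
    then show ?case
      by (simp add: distrib_left eval_ac_add)
  qed
next
  case (add f g)
  then show ?case
    by (simp add: distrib_right eval_ac_add)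
qed

lemma eval_ac_power: "eval_ac x (p ^ k) = eval_ac x p ^ k"
  by (induction k) (simp_all add: eval_ac_mult)

lemma eval_ac_prod: "eval_ac x (prod f A) = (\<Prod>i\<in>A. eval_ac x (f i))"
  by (induction A rule: infinite_finite_induct) (simp_all add: eval_ac_mult)

lemma eval_ac_mvar [simp]: "eval_ac x (mvar i) = x i"
  by (simp add: mvar_def eval_ac_single)

lemma eval_ac_mconst [simp]: "eval_ac x (mconst c) = to_ac c"
  by (simp add: mconst_def eval_ac_single)

text \<open>Evaluation is a ring homomorphism, and a finite product in a field vanishes iff some
  factor does. Finiteness matters because \<open>prod\<close> over an infinite set is 1. A vertex
  without out-neighbours makes both sides false.\<close>

lemma solvable_H_system_iff:
  assumes "\<And>i. i \<in> pverts G \<Longrightarrow> finite (out_nbrs G i)"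
  shows "solvable_over_ac (H_system G n \<omega>) \<longleftrightarrow>
    (\<exists>x. \<forall>i\<in>pverts G. x i ^ n = 1 \<and> (\<exists>j\<in>out_nbrs G i. x j = to_ac \<omega> * x i))"
proof -
  have "eval_ac x (\<Prod>j\<in>out_nbrs G i. (mconst \<omega> * mvar i - mvar j)) = 0 \<longleftrightarrow>
      (\<exists>j\<in>out_nbrs G i. x j = to_ac \<omega> * x i)" if "i \<in> pverts G" for x i
    using assms [OF that] by (auto simp: eval_ac_prod eval_ac_diff eval_ac_mult intro: sym)
  then show ?thesis
    unfolding solvable_over_ac_def H_system_def
    by (simp add: eval_ac_diff eval_ac_power)
qed

text \<open>Cancelling the smaller power leaves a power equal to 1 with exponent below
  \<open>n\<close>, which primitivity allows only for exponent 0.\<close>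

lemma primitive_nth_root_power_inj:
  assumes "primitive_nth_root n \<zeta>" "\<zeta> ^ a = \<zeta> ^ b" "a < n" "b < n"
  shows "a = b"
proof -
  have *: "a = b" if "a \<le> b" "\<zeta> ^ a = \<zeta> ^ b" "b < n" for a b
  proof (rule ccontr)
    assume "a \<noteq> b"
    have "\<zeta> \<noteq> 0"
      using assms(1) by (auto simp: primitive_nth_root_def power_0_left split: if_splits)
    moreover have "\<zeta> ^ a * \<zeta> ^ (b - a) = \<zeta> ^ a * 1"
      using power_add [of \<zeta> a "b - a"] that by simp
    ultimately have "\<zeta> ^ (b - a) = 1"
      by simp
    then show False
      using assms(1) that \<open>a \<noteq> b\<close> unfolding primitive_nth_root_def
      by (metis diff_less_mono2 diff_zero le_neq_implies_less less_imp_diff_less zero_less_diff)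
  qed
  show ?thesis
    using *[of a b] *[of b a] assms by (cases "a \<le> b") auto
qed

text \<open>The embedding \<open>to_ac\<close> is an injective homomorphism, so it preserves and
  reflects which powers equal 1.\<close>

lemma primitive_nth_root_to_ac:
  "primitive_nth_root n (to_ac \<omega>) \<longleftrightarrow> primitive_nth_root n \<omega>"
  unfolding primitive_nth_root_def by (simp flip: to_ac_power)

lemma hamiltonian_cycle_of_root_labelling:
  fixes x :: "'v \<Rightarrow> 'a::field"
  assumes prim: "primitive_nth_root n \<zeta>" and "finite (pverts G)" and card: "card (pverts G) = n"
    and arcs: "parcs G \<subseteq> pverts G \<times> pverts G"
    and root: "\<And>i. i \<in> pverts G \<Longrightarrow> x i ^ n = 1"
    and step: "\<And>i. i \<in> pverts G \<Longrightarrow> \<exists>j\<in>out_nbrs G i. x j = \<zeta> * x i"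
  shows "\<exists>vs. hamiltonian_cycle G vs"
proof -
  have "n > 0"
    using prim by (simp add: primitive_nth_root_def)
  obtain f where f: "\<And>i. i \<in> pverts G \<Longrightarrow> (i, f i) \<in> parcs G \<and> x (f i) = \<zeta> * x i"
    using step unfolding out_nbrs_def by (metis mem_Collect_eq)
  obtain r where r: "r \<in> pverts G"
    using card \<open>n > 0\<close> by fastforce
  define v where "v k = (f ^^ k) r" for k
  have v_Suc: "v (Suc k) = f (v k)" for k
    by (simp add: v_def)
  have v_mem: "v k \<in> pverts G" for k
  proof (induction k)
    case (Suc k)
    then show ?case
      using f [of "v k"] arcs by (auto simp: v_Suc)
  qed (simp add: v_def r)
  have arc: "(v k, v (Suc k)) \<in> parcs G" for k
    using f [OF v_mem] by (simp add: v_Suc)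
  have x_v: "x (v k) = \<zeta> ^ k * x r" for k
    by (induction k) (use f v_mem in \<open>simp_all add: v_Suc\<close>, simp add: v_def)
  \<comment> \<open>This allows \<open>x r\<close> to be cancelled when labels along the walk are
    compared.\<close>
  have "x r \<noteq> 0"
    using root [OF r] \<open>n > 0\<close> by (auto simp: power_0_left split: if_splits)
  then have inj: "a = b" if "x (v a) = x (v b)" "a < n" "b < n" for a b
    using that primitive_nth_root_power_inj [OF prim] by (simp add: x_v)
  have "inj_on v {..<n}"
    by (rule inj_onI) (use inj in auto)
  \<comment> \<open>The first \<open>n\<close> vertices of the walk are distinct, and there are only
    \<open>n\<close> vertices in all.\<close>
  then have onto: "v ` {..<n} = pverts G"
    using \<open>finite (pverts G)\<close> card v_mem
    by (intro card_subset_eq) (auto simp: card_image)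
  \<comment> \<open>Labels separate only the steps below \<open>n\<close>, so \<open>v n\<close> is
    first identified with some earlier \<open>v k\<close>; its label then forces
    \<open>k = 0\<close>.\<close>
  have "v n = v 0"
  proof -
    obtain k where "k < n" "v n = v k"
      using v_mem [of n] onto by (metis imageE lessThan_iff)
    moreover have "x (v n) = x (v 0)"
      using prim by (simp add: x_v primitive_nth_root_def)
    ultimately show ?thesis
      using inj [of k 0] \<open>n > 0\<close> by simp
  qed
  then have "(v (n - 1), v 0) \<in> parcs G"
    using arc [of "n - 1"] \<open>n > 0\<close> by simp
  then have "hamiltonian_cycle G (map v [0..<n])"
    using \<open>n > 0\<close> \<open>inj_on v {..<n}\<close> onto arc
    by (simp add: hamiltonian_cycle_def distinct_map last_map hd_map atLeast0LessThan)
  then show ?thesis ..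
qed

lemma root_labelling_of_hamiltonian_cycle:
  fixes \<zeta> :: "'a::field"
  assumes root: "\<zeta> ^ n = 1" and ham: "hamiltonian_cycle G vs" and card: "card (pverts G) = n"
  shows "\<exists>x. \<forall>i\<in>pverts G. x i ^ n = 1 \<and> (\<exists>j\<in>out_nbrs G i. x j = \<zeta> * x i)"
proof -
  have "vs \<noteq> []" "distinct vs" and vs: "set vs = pverts G"
    and arc: "\<And>k. Suc k < length vs \<Longrightarrow> (vs ! k, vs ! Suc k) \<in> parcs G"
    and closing: "(last vs, hd vs) \<in> parcs G"
    using ham by (auto simp: hamiltonian_cycle_def)
  have len: "length vs = n"
    using card vs distinct_card [OF \<open>distinct vs\<close>] by simp
  have "inj_on ((!) vs) {..<n}"
    using \<open>distinct vs\<close> len by (auto intro!: inj_onI simp: nth_eq_iff_index_eq)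
  \<comment> \<open>The exponent is the position of \<open>i\<close> in \<open>vs\<close>, well
    defined because \<open>vs\<close> is distinct.\<close>
  define x where "x i = \<zeta> ^ inv_into {..<n} ((!) vs) i" for i
  have x_nth: "x (vs ! k) = \<zeta> ^ k" if "k < n" for k
    using that \<open>inj_on ((!) vs) {..<n}\<close> by (simp add: x_def)
  have "x i ^ n = 1 \<and> (\<exists>j\<in>out_nbrs G i. x j = \<zeta> * x i)" if "i \<in> pverts G" for i
  proof -
    obtain k where k: "k < n" "i = vs ! k"
      using \<open>i \<in> pverts G\<close> vs len by (metis in_set_conv_nth)
    have "x i ^ n = 1"
      using k root by (simp add: x_nth) (metis mult.commute power_mult power_one)
    moreover have "\<exists>j\<in>out_nbrs G i. x j = \<zeta> * x i"
    proof (cases "Suc k < n")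
      case True
      then show ?thesis
        using arc [of k] k len by (intro bexI [of _ "vs ! Suc k"]) (auto simp: x_nth out_nbrs_def)
    next
      case False
      \<comment> \<open>At the last position the successor is the head, labelled 1, and
        \<open>\<zeta> * \<zeta> ^ k = \<zeta> ^ n = 1\<close>.\<close>
      then have "n = Suc k"
        using k by simp
      then have "vs ! k = last vs" "vs ! 0 = hd vs"
        using \<open>vs \<noteq> []\<close> len by (auto simp: last_conv_nth hd_conv_nth)
      then show ?thesis
        using closing k x_nth [of 0] x_nth [of k] root \<open>n = Suc k\<close>
        by (intro bexI [of _ "vs ! 0"]) (auto simp: x_nth out_nbrs_def)
    qed
    ultimately show ?thesis ..
  qed
  then show ?thesis
    by blast
qed

theorem proposition1p3:
  fixes G :: "nat pair_pre_digraph" and n :: nat and \<omega> :: "'k::field"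
  assumes "pair_digraph G"
    and "pverts G = {1..n}"
    and "\<not> CHAR('k) dvd n"
    and "primitive_nth_root n \<omega>"
  shows "solvable_over_ac (H_system G n \<omega>) \<longleftrightarrow> (\<exists>vs. hamiltonian_cycle G vs)"
proof -
  interpret pair_digraph G
    by fact
  have arcs: "parcs G \<subseteq> pverts G \<times> pverts G"
    using in_arcsD1 in_arcsD2 by auto
  then have "finite (out_nbrs G i)" for i
    by (rule_tac finite_subset [of _ "pverts G"]) (auto simp: out_nbrs_def assms(2))
  \<comment> \<open>From here on no polynomials occur: both directions concern vertex labellings in
    the algebraic closure, with \<open>to_ac \<omega>\<close> as the root of unity.\<close>
  then have solvable: "solvable_over_ac (H_system G n \<omega>) \<longleftrightarrow>
      (\<exists>x. \<forall>i\<in>pverts G. x i ^ n = 1 \<and> (\<exists>j\<in>out_nbrs G i. x j = to_ac \<omega> * x i))"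
    by (rule solvable_H_system_iff)
  have prim: "primitive_nth_root n (to_ac \<omega>)"
    using assms(4) by (simp add: primitive_nth_root_to_ac)
  have card: "card (pverts G) = n"
    by (simp add: assms(2))
  show ?thesis
    unfolding solvable
  proof
    assume "\<exists>x. \<forall>i\<in>pverts G. x i ^ n = 1 \<and> (\<exists>j\<in>out_nbrs G i. x j = to_ac \<omega> * x i)"
    then show "\<exists>vs. hamiltonian_cycle G vs"
      using hamiltonian_cycle_of_root_labelling [OF prim pair_finite_verts card arcs] by blast
  next
    assume "\<exists>vs. hamiltonian_cycle G vs"
    then show "\<exists>x. \<forall>i\<in>pverts G. x i ^ n = 1 \<and> (\<exists>j\<in>out_nbrs G i. x j = to_ac \<omega> * x i)"
      using root_labelling_of_hamiltonian_cycle [OF _ _ card] prim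
      by (auto simp: primitive_nth_root_def)
  qed
qed

end
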